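(* Let $\ell\in N$, let $S\subseteq[\ell]$ and $\bar S=[\ell]\setminus S$. For every $i\in(\bar S\setminus\{1\})\cup\{\ell+1\}$ let $T_{i-1}=\{t_{i-1(1)},\dots,t_{i-1(a_{i-1})}\}\subseteq T^*_{i-1}$ be a set of $a_{i-1}$ scenarios indexed so that $D_{t_{i-1(1)}}\ge\cdots\ge D_{t_{i-1(a_{i-1})}}$, and put $t_{i-1(a_{i-1}+1)}=\sigma_{i-1(k+1)}$; in addition fix $t_{\ell(1)}=\sigma_{\ell(1)}$. Let $\bar T=\big(\bigcup_{i\in\bar S}T_{i-1}\big)\cup T_\ell$ and let $\bar\alpha_j$, $j\in\bar T$, be the coefficients defined in the context. Suppose that (1) $\bar S\ne\emptyset$ and $1\in S$; (2) $T_{p-1}\cap T^*_{q-1}=\emptyset$ for all $p,q\in\bar S$ with $p\ne q$; $T_{p-1}\cap T^*_\ell=\emptyset$ for all $p\in\bar S$; and $T_\ell\cap T^*_{q-1}=\emptyset$ for all $q\in\bar S$; (3) $D_{t_{\ell(1)}}-D_{t_{i-1(a_{i-1}+1)}}<M_i$ for all $i\in\bar S$; (4) $d_{ji}>0$ for all $j\in\Omega$ and $i\in N$. Then the inequality $$\sum_{i\in S}y_i+\sum_{i\in\bar S}\big(D_{t_{\ell(1)}}-D_{t_{i-1(1)}}\big)x_i+\sum_{j\in\bar T}\bar\alpha_jz_j\ \ge\ D_{t_{\ell(1)}}$$ is facet-defining for $\mathrm{conv}(P)$.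
   Context: For a positive integer $r$, $[r]=\{1,\dots,r\}$. $N=\{1,\dots,n\}$ is the set of time periods and $\Omega=\{1,\dots,m\}$ is the set of scenarios, all with probability $1/m$. $d_{ji}$ is the demand in period $i$ under scenario $j$; $0\le\epsilon<1$ is a given risk level and $k=\lfloor m\epsilon\rfloor$. $M_i=\max_{j\in\Omega}\sum_{p=i}^n d_{jp}$ for $i\in N$. The set $P$ is the set of all $(\mathbf x,\mathbf y,\mathbf z)\in\{0,1\}^n\times\mathbb R_+^n\times\{0,1\}^m$ satisfying $\sum_{i=1}^t y_i\ge\sum_{i=1}^t d_{ji}(1-z_j)$ for all $t\in N,\ j\in\Omega$; $\ \sum_{j=1}^m z_j\le k$; $\ y_i\le M_ix_i$ for all $i\in N$. Cumulative demands: $D_{ji}=\sum_{p=1}^i d_{jp}$. For each $i\in N$, $\sigma_{i(1)},\dots,\sigma_{i(m)}$ is a fixed ordering of the scenarios with $D_{\sigma_{i(1)}i}\ge D_{\sigma_{i(2)}i}\ge\cdots\ge D_{\sigma_{i(m)}i}$, and $T_i^*=\{\sigma_{i(1)},\dots,\sigma_{i(k)}\}$. For scenarios written as $\sigma_{i(p)}$ or $t_{i(p)}$ the period index is dropped: $D_{\sigma_{i(p)}}=D_{\sigma_{i(p)}i}$ and $D_{t_{i(p)}}=D_{t_{i(p)}i}$. If $T_i=\emptyset$ then $a_i=0$ and $t_{i(1)}=\sigma_{i(k+1)}$. Coefficients: for $j\in\bar T$ and an index $i$ with $i=\ell$ or $i+1\in\bar S$, $\alpha_{ji}=0$ if $j\notin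 T_i$, and $\alpha_{ji}=D_{t_{i(p)}}-D_{t_{i(p+1)}}$ if $j=t_{i(p)}\in T_i$ for some $p\in[a_i]$. Then $\bar\alpha_j=\max\{\max_{i\in\bar S}\{\alpha_{j(i-1)}\},\alpha_{j\ell}\}$. *)

theory Defs
  imports "HOL-Analysis.Analysis"
begin

text \<open>
  Periods are the natural numbers \<open>1, \<dots>, n\<close>; scenarios are the elements of a finite type
  \<open>'m\<close>, so that \<open>m = CARD('m)\<close> (no order on scenarios is used other than the orderings
  \<open>\<sigma> i\<close>, which are data).  Points live in the Euclidean space
  \<open>real^'n \<times> real^'n \<times> real^'m\<close>; a bijection \<open>per\<close> from \<open>{1..n}\<close> onto the index type
  \<open>'n\<close> names the coordinate \<open>per i\<close> that belongs to period \<open>i\<close>.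
\<close>

definition cum_demand :: "('m \<Rightarrow> nat \<Rightarrow> real) \<Rightarrow> 'm \<Rightarrow> nat \<Rightarrow> real" where
  "cum_demand d j i = (\<Sum>p=1..i. d j p)"

definition big_M :: "('m::finite \<Rightarrow> nat \<Rightarrow> real) \<Rightarrow> nat \<Rightarrow> nat \<Rightarrow> real" where
  "big_M d n i = Max (range (\<lambda>j. \<Sum>p=i..n. d j p))"

definition lot_sizing_set ::
  "(nat \<Rightarrow> 'n::finite) \<Rightarrow> nat \<Rightarrow> ('m::finite \<Rightarrow> nat \<Rightarrow> real) \<Rightarrow> nat \<Rightarrow>
    ((real^'n) \<times> (real^'n) \<times> (real^'m)) set" where
  "lot_sizing_set per n d k = {(x, y, z).
     (\<forall>i\<in>{1..n}. x $ per i \<in> {0, 1}) \<and>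
     (\<forall>i\<in>{1..n}. 0 \<le> y $ per i) \<and>
     (\<forall>j. z $ j \<in> {0, 1}) \<and>
     (\<forall>t\<in>{1..n}. \<forall>j. (\<Sum>i=1..t. y $ per i) \<ge> (\<Sum>i=1..t. d j i * (1 - z $ j))) \<and>
     (\<Sum>j\<in>UNIV. z $ j) \<le> real k \<and>
     (\<forall>i\<in>{1..n}. y $ per i \<le> big_M d n i * x $ per i)}"

text \<open>
  \<open>\<sigma> i p\<close> is the scenario with the \<open>p\<close>-th largest cumulative demand up to period \<open>i\<close>
  (positions start at 1).
\<close>

definition demand_ordering ::
  "('m::finite \<Rightarrow> nat \<Rightarrow> real) \<Rightarrow> nat \<Rightarrow> (nat \<Rightarrow> 'm) \<Rightarrow> bool" where
  "demand_ordering d i s \<longleftrightarrow>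
     bij_betw s {1..CARD('m)} UNIV \<and>
     antimono_on {1..CARD('m)} (\<lambda>p. cum_demand d (s p) i)"

definition top_scenarios :: "(nat \<Rightarrow> nat \<Rightarrow> 'm) \<Rightarrow> nat \<Rightarrow> nat \<Rightarrow> 'm set" where
  "top_scenarios \<sigma> k i = \<sigma> i ` {1..k}"

text \<open>
  When \<open>t i\<close> is injective on \<open>{1..a i}\<close> with image \<open>T i\<close>, the value of \<open>inv_into\<close> below is
  the unique \<open>p \<in> {1..a i}\<close> with \<open>j = t i p\<close>.
\<close>

definition alpha ::
  "('m \<Rightarrow> nat \<Rightarrow> real) \<Rightarrow> (nat \<Rightarrow> 'm set) \<Rightarrow> (nat \<Rightarrow> nat) \<Rightarrow> (nat \<Rightarrow> nat \<Rightarrow> 'm) \<Rightarrow>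
    'm \<Rightarrow> nat \<Rightarrow> real" where
  "alpha d T a t j i =
     (if j \<in> T i then
        let p = inv_into {1..a i} (t i) j
        in cum_demand d (t i p) i - cum_demand d (t i (p + 1)) i
      else 0)"

text \<open>The inner \<open>Max\<close> is meaningful only for nonempty \<open>Sbar\<close>.\<close>

definition alpha_bar ::
  "('m \<Rightarrow> nat \<Rightarrow> real) \<Rightarrow> (nat \<Rightarrow> 'm set) \<Rightarrow> (nat \<Rightarrow> nat) \<Rightarrow> (nat \<Rightarrow> nat \<Rightarrow> 'm) \<Rightarrow>
    nat set \<Rightarrow> nat \<Rightarrow> 'm \<Rightarrow> real" where
  "alpha_bar d T a t Sbar l j =
     max (Max ((\<lambda>i. alpha d T a t j (i - 1)) ` Sbar)) (alpha d T a t j l)"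

text \<open>The linear inequality \<open>f v \<ge> b\<close> is valid for \<open>Q\<close> and its face is a facet of \<open>Q\<close>.\<close>

definition facet_defining ::
  "('a::euclidean_space \<Rightarrow> real) \<Rightarrow> real \<Rightarrow> 'a set \<Rightarrow> bool" where
  "facet_defining f b Q \<longleftrightarrow>
     linear f \<and> (\<forall>v\<in>Q. f v \<ge> b) \<and> {v \<in> Q. f v = b} facet_of Q"

end

(* For a period i in Sbar, or i = l + 1, and 0 <= q <= a (i - 1) the following point is tight: produce
   D_{t_{i-1}(q+1)} in period 1 and M_i in period i, and give up the scenarios t_{i-1}(1), ..., t_{i-1}(q)
   together with all top-k scenarios at i - 1 that demand more than t_{i-1}(q+1); by condition (2) the
   additional ones do not occur in the inequality. Consider a linear functional that is constant on the
   tight points. Perturbing these points (opening a further setup, moving a small amount of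
   production from period 1 to a later period of S, lowering M_i to D_{t_l(1)} - D_{t_{i-1}(1)}, which
   condition (3) makes smaller than M_i, giving up one more scenario) and comparing consecutive
   q determines all its coefficients up to the factor pi_1, except that of x_1, which equals 1 on P. *)

theory Submission
  imports Defs
begin

section \<open>Facets of a convex hull\<close>

text \<open>The face and \<open>u\<close> affinely span \<open>P\<close>: for a hyperplane through both, \<open>unique\<close> gives
  \<open>r = 0\<close> on evaluating at \<open>u\<close>, so it contains \<open>P\<close>.\<close>

lemma facet_defining_convex_hullI:
  fixes f :: "'a::euclidean_space \<Rightarrow> real"
  assumes lin: "linear f"
    and valid: "\<And>v. v \<in> P \<Longrightarrow> b \<le> f v"
    and tight: "w \<in> P" "f w = b"
    and proper: "u \<in> P" "f u \<noteq> b"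
    and unique: "\<And>g c. (\<And>v. v \<in> P \<Longrightarrow> f v = b \<Longrightarrow> g \<bullet> v = c) \<Longrightarrow>
                   \<exists>r. \<forall>v\<in>P. g \<bullet> v - c = r * (f v - b)"
  shows "facet_defining f b (convex hull P)"
proof -
  let ?Q = "convex hull P" and ?F = "{v \<in> convex hull P. f v = b}"
  \<comment> \<open>The vector that represents \<open>f\<close> as an inner product, so that
    halfspace and face lemmas apply.\<close>
  define e where "e = adjoint f 1"
  have f: "f v = e \<bullet> v" for v
    using adjoint_works[OF lin, of v 1] by (simp add: e_def inner_commute)
  have "?Q \<subseteq> {v. e \<bullet> v \<ge> b}"
    using valid by (intro hull_minimal convex_halfspace_ge) (auto simp: f)
  then have validQ: "f v \<ge> b" if "v \<in> ?Q" for v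
    using that by (auto simp: f)
  have face: "?F face_of ?Q"
    using face_of_Int_supporting_hyperplane_ge[of ?Q b e] validQ
    by (simp add: f Int_def convex_convex_hull)
  have w: "w \<in> ?F" and u: "u \<in> ?Q" "u \<notin> ?F"
    using tight proper by (auto simp: hull_inc)
  have "P \<subseteq> affine hull (insert u ?F)"
  proof
    fix v assume v: "v \<in> P"
    show "v \<in> affine hull (insert u ?F)"
    proof (rule ccontr)
      assume nv: "v \<notin> affine hull (insert u ?F)"
      \<comment> \<open>An affine hull is an intersection of hyperplanes, so one of them misses
        \<open>v\<close>.\<close>
      obtain H where H: "affine hull (insert u ?F) = \<Inter>H"
          "\<And>h. h \<in> H \<Longrightarrow> \<exists>g c. g \<noteq> 0 \<and> h = {x. g \<bullet> x = c}"
        using affine_hull_finite_intersection_hyperplanes[of "insert u ?F"] by metis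
      then obtain g c where gc: "{x. g \<bullet> x = c} \<in> H" "g \<bullet> v \<noteq> c"
        using nv by blast
      have sub: "insert u ?F \<subseteq> {x. g \<bullet> x = c}"
        using H(1) gc(1) hull_subset[of "insert u ?F" affine] by blast
      then have "g \<bullet> x = c" if "x \<in> P" "f x = b" for x
        using that by (auto simp: hull_inc subset_iff)
      then obtain r where r: "\<And>x. x \<in> P \<Longrightarrow> g \<bullet> x - c = r * (f x - b)"
        using unique by blast
      have "r = 0"
        using r[OF proper(1)] proper(2) sub by auto
      then show False
        using r[OF v] gc(2) by simp
    qed
  qed
  then have "?Q \<subseteq> affine hull (insert u ?F)"
    by (intro hull_minimal affine_imp_convex affine_affine_hull)
  \<comment> \<open>Adding \<open>u\<close> raises the dimension of the face by at most one, and a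
    proper face has smaller dimension, so the gap is exactly one.\<close>
  then have "aff_dim ?Q \<le> aff_dim (insert u ?F)"
    using aff_dim_subset aff_dim_affine_hull by metis
  also have "\<dots> \<le> aff_dim ?F + 1"
    by (simp add: aff_dim_insert)
  finally have "aff_dim ?Q \<le> aff_dim ?F + 1" .
  moreover have "aff_dim ?F < aff_dim ?Q"
    using face u by (intro face_of_aff_dim_lt convex_convex_hull) auto
  ultimately have "?F facet_of ?Q"
    using face w unfolding facet_of_def by force
  then show ?thesis
    using lin validQ by (simp add: facet_defining_def)
qed

section \<open>Sums over updated functions, cumulative demands and bounds by
  \<open>big_M\<close>\<close>

text \<open>The points below are constant functions with a few entries overwritten; this evaluates a
  linear form on them one overwrite at a time.\<close>

lemma sum_fun_upd_weighted:
  fixes w :: "'a \<Rightarrow> 'b::comm_ring_1"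
  assumes "finite A"
  shows "(\<Sum>i\<in>A. w i * (f(h := c)) i) =
    (\<Sum>i\<in>A. w i * f i) + (if h \<in> A then w h * (c - f h) else 0)"
proof -
  have "(\<Sum>i\<in>A. w i * (f(h := c)) i) =
      (\<Sum>i\<in>A. w i * f i + (if i = h then w h * (c - f h) else 0))"
    by (intro sum.cong) (auto simp: algebra_simps)
  then show ?thesis
    using assms by (simp add: sum.distrib)
qed

lemmas sum_fun_upd = sum_fun_upd_weighted[where w = "\<lambda>_. 1", simplified]

lemma sum_diff_Suc:
  fixes f :: "nat \<Rightarrow> 'a::ab_group_add"
  shows "(\<Sum>p=1..q. f p - f (p + 1)) = f 1 - f (q + 1)"
  by (induction q) auto

lemma cum_demand_split:
  assumes "i \<le> t"
  shows "cum_demand d j t = cum_demand d j i + (\<Sum>p=i+1..t. d j p)"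
proof -
  have "{1..t} = {1..i} \<union> {i+1..t}"
    using assms by auto
  then show ?thesis
    unfolding cum_demand_def by (simp add: sum.union_disjoint)
qed

lemma big_M_ge:
  fixes d :: "'m::finite \<Rightarrow> nat \<Rightarrow> real"
  shows "(\<Sum>p=i..n. d j p) \<le> big_M d n i"
  unfolding big_M_def by (rule Max_ge) auto

locale positive_demand =
  fixes d :: "'m::finite \<Rightarrow> nat \<Rightarrow> real" and n :: nat
  assumes demand_pos: "i \<in> {1..n} \<Longrightarrow> 0 < d j i"
begin

lemma cum_demand_mono:
  assumes "i \<le> t" "t \<le> n"
  shows "cum_demand d j i \<le> cum_demand d j t"
proof -
  have "0 \<le> (\<Sum>p=i+1..t. d j p)"
    using assms demand_pos by (intro sum_nonneg) (auto intro: less_imp_le)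
  then show ?thesis
    using cum_demand_split[OF assms(1), of d j] by simp
qed

lemma cum_demand_add_le:
  assumes "i < h" "h \<le> t" "t \<le> n"
  shows "cum_demand d j i + d j h \<le> cum_demand d j t"
proof -
  have "d j h \<le> (\<Sum>p=i+1..t. d j p)"
    using assms demand_pos by (intro member_le_sum) (auto intro: less_imp_le)
  then show ?thesis
    using assms by (subst cum_demand_split[of i t]) auto
qed

lemma cum_demand_strict:
  assumes "i < t" "t \<le> n"
  shows "cum_demand d j i < cum_demand d j t"
  using cum_demand_add_le[of i t t j] demand_pos[of t j] assms by simp

text \<open>Full production in period \<open>i\<close> covers all demand from \<open>i\<close> on in
  every scenario, because \<open>big_M\<close> is a maximum of such demands through
  \<open>n\<close>.\<close>

lemma cum_demand_le_big_M:
  assumes "1 \<le> i" "i \<le> t + 1" "t \<le> n"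
  shows "cum_demand d j t \<le> cum_demand d j (i - 1) + big_M d n i"
proof -
  have "(\<Sum>p=i..t. d j p) \<le> (\<Sum>p=i..n. d j p)"
    using assms demand_pos by (intro sum_mono2) (auto intro: less_imp_le)
  also have "\<dots> \<le> big_M d n i"
    by (rule big_M_ge)
  finally show ?thesis
    using assms by (subst cum_demand_split[of "i - 1" t]) auto
qed

lemma demand_le_big_M:
  assumes "i \<in> {1..n}"
  shows "d j i \<le> big_M d n i"
proof -
  have "d j i \<le> (\<Sum>p=i..n. d j p)"
    using assms demand_pos by (intro member_le_sum) (auto intro: less_imp_le)
  then show ?thesis
    using big_M_ge order_trans by blast
qed

lemma big_M_nonneg:
  assumes "1 \<le> i"
  shows "0 \<le> big_M d n i"
proof -
  have "0 \<le> (\<Sum>p=i..n. d undefined p)"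
    using assms demand_pos by (intro sum_nonneg) (auto intro: less_imp_le)
  then show ?thesis
    using big_M_ge order_trans by blast
qed

end

section \<open>Giving up scenarios at one fixed period\<close>

text \<open>\<open>C\<close> stands for the cumulative demand at one period, \<open>s\<close> for
  its ordering and \<open>U\<close> for the chosen part of the top \<open>k\<close>. The entry
  \<open>t (a + 1)\<close> is a sentinel that bounds \<open>U\<close> from below; for empty
  \<open>U\<close> it is \<open>t 1\<close>.\<close>

locale scenario_selection =
  fixes C :: "'m::finite \<Rightarrow> real" and s :: "nat \<Rightarrow> 'm" and k a :: nat
    and U :: "'m set" and t :: "nat \<Rightarrow> 'm"
  assumes bij_s: "bij_betw s {1..CARD('m)} UNIV"
    and anti_s: "antimono_on {1..CARD('m)} (\<lambda>p. C (s p))"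
    and k_less: "k < CARD('m)"
    and U_sub: "U \<subseteq> s ` {1..k}"
    and bij_t: "bij_betw t {1..a} U"
    and anti_t: "antimono_on {1..a} (\<lambda>p. C (t p))"
    and t_last: "t (a + 1) = s (k + 1)"
begin

lemma C_s_anti:
  assumes "1 \<le> p" "p \<le> q" "q \<le> CARD('m)"
  shows "C (s q) \<le> C (s p)"
  using monotone_onD[OF anti_s, of p q] assms by auto

lemma C_top:
  assumes "j \<in> s ` {1..k+1}"
  shows "C (s (k + 1)) \<le> C j"
  using assms k_less by (auto intro!: C_s_anti)

lemma C_not_top:
  assumes "j \<notin> s ` {1..k}"
  shows "C j \<le> C (s (k + 1))"
proof -
  obtain p where p: "p \<in> {1..CARD('m)}" "j = s p"
    using bij_s unfolding bij_betw_def by blast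
  then have "k + 1 \<le> p"
    using assms by (cases "p \<le> k") auto
  then show ?thesis
    using p by (auto intro: C_s_anti)
qed

lemma C_t_last:
  assumes "p \<in> {1..a+1}"
  shows "C (t (a + 1)) \<le> C (t p)"
proof (cases "p = a + 1")
  case False
  then have "t p \<in> U"
    using assms bij_t by (auto simp: bij_betw_def)
  then show ?thesis
    using U_sub by (auto simp: t_last simp del: One_nat_def intro!: C_top)
qed simp

lemma C_t_anti:
  assumes "1 \<le> p" "p \<le> q" "q \<le> a + 1"
  shows "C (t q) \<le> C (t p)"
proof (cases "q = a + 1")
  case True
  then show ?thesis
    using C_t_last[of p] assms by auto
next
  case False
  then show ?thesis
    using monotone_onD[OF anti_t, of p q] assms by auto
qed

text \<open>If \<open>C (t (q + 1))\<close> units are available, the second set must be given up.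
  The first set also contains those of \<open>t 1\<close> to \<open>t q\<close> that tie with
  \<open>t (q + 1)\<close> and escape the strict comparison.\<close>

definition cut :: "nat \<Rightarrow> 'm set" where
  "cut q = t ` {1..q} \<union> {j \<in> s ` {1..k}. C (t (q + 1)) < C j}"

lemma cut_sub:
  assumes "q \<le> a"
  shows "cut q \<subseteq> s ` {1..k}"
proof -
  have "t ` {1..q} \<subseteq> U"
    using assms bij_t by (auto simp: bij_betw_def)
  then show ?thesis
    using U_sub by (auto simp: cut_def)
qed

lemma card_cut:
  assumes "q \<le> a"
  shows "card (cut q) \<le> k"
proof -
  have "card (cut q) \<le> card (s ` {1..k})"
    using cut_sub[OF assms] by (intro card_mono) auto
  also have "\<dots> \<le> k"
    using card_image_le[of "{1..k}" s] by simp
  finally show ?thesis .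
qed

text \<open>Scenarios outside the top \<open>k\<close> are bounded by the one in position
  \<open>k + 1\<close>. That one is the sentinel, where \<open>C\<close> is smallest along
  \<open>t\<close>.\<close>

lemma C_le_cut:
  assumes "q \<le> a" "j \<notin> cut q"
  shows "C j \<le> C (t (q + 1))"
proof (cases "j \<in> s ` {1..k}")
  case True
  then show ?thesis
    using assms by (auto simp: cut_def not_less)
next
  case False
  then have "C j \<le> C (t (a + 1))"
    unfolding t_last by (rule C_not_top)
  also have "\<dots> \<le> C (t (q + 1))"
    using assms by (intro C_t_last) auto
  finally show ?thesis .
qed

text \<open>\<open>C\<close> is nonincreasing along \<open>t\<close>, so a member of
  \<open>U\<close> above \<open>C (t (q + 1))\<close> occurs at a position at most
  \<open>q\<close>.\<close>

lemma cut_Int: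
  assumes "q \<le> a"
  shows "cut q \<inter> U = t ` {1..q}"
proof -
  have sub: "t ` {1..q} \<subseteq> U"
    using assms bij_t by (auto simp: bij_betw_def)
  have "j \<in> t ` {1..q}" if j: "j \<in> U" "C (t (q + 1)) < C j" for j
  proof -
    obtain p where p: "p \<in> {1..a}" "j = t p"
      using j(1) bij_t unfolding bij_betw_def by blast
    have "p \<le> q"
    proof (rule ccontr)
      assume "\<not> p \<le> q"
      then have "C (t p) \<le> C (t (q + 1))"
        using p by (intro C_t_anti) auto
      then show False
        using p j by simp
    qed
    then show ?thesis
      using p by auto
  qed
  then show ?thesis
    using sub by (auto simp: cut_def)
qed

text \<open>If the first unselected \<open>t q\<close> has \<open>q \<le> a\<close>, it bounds \<open>r\<close> from below; otherwise all of
  \<open>U\<close> is selected, and one of the \<open>k + 1\<close> largest scenarios is not.\<close>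

lemma selection_bound:
  assumes card: "card Z \<le> k" and r: "\<And>j. j \<notin> Z \<Longrightarrow> C j \<le> r"
  shows "C (t 1) \<le> r + (\<Sum>p\<in>{p\<in>{1..a}. t p \<in> Z}. C (t p) - C (t (p + 1)))"
proof -
  define q where "q = (LEAST q. q = a \<or> t (q + 1) \<notin> Z)"
  have stop: "q = a \<or> t (q + 1) \<notin> Z"
    unfolding q_def by (rule LeastI[of _ a]) simp
  have qa: "q \<le> a"
    unfolding q_def by (rule Least_le) simp
  have below: "t p \<in> Z" if "p \<in> {1..q}" for p
  proof -
    have "p - 1 < q" "p - 1 + 1 = p"
      using that by auto
    then show ?thesis
      using not_less_Least[of "p - 1" "\<lambda>q. q = a \<or> t (q + 1) \<notin> Z"] unfolding q_def by metis
  qed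
  from stop have "C (t (q + 1)) \<le> r"
  proof
    assume "q = a"
    have "inj_on s {1..k+1}"
      using bij_s by (rule bij_betw_imp_inj_on[THEN inj_on_subset]) (use k_less in auto)
    then have "card (s ` {1..k+1}) = k + 1"
      by (simp add: card_image)
    then have "\<not> s ` {1..k+1} \<subseteq> Z"
      using card card_mono[of Z "s ` {1..k+1}"] finite[of Z] by linarith
    then obtain j where "j \<in> s ` {1..k+1}" "j \<notin> Z"
      by blast
    then show ?thesis
      using C_top r \<open>q = a\<close> t_last by fastforce
  qed (use r in auto)
  \<comment> \<open>Positions \<open>1\<close> to \<open>q\<close> telescope to
    \<open>C (t 1) - C (t (q + 1))\<close>; selected positions beyond \<open>q\<close> add
    nonnegative terms.\<close>
  moreover have "(\<Sum>p=1..q. C (t p) - C (t (p + 1))) \<le>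
      (\<Sum>p\<in>{p\<in>{1..a}. t p \<in> Z}. C (t p) - C (t (p + 1)))"
    using below qa C_t_anti by (intro sum_mono2) auto
  ultimately show ?thesis
    using sum_diff_Suc[of "\<lambda>p. C (t p)" q] by linarith
qed

end

section \<open>Feasible plans and the points they represent\<close>

text \<open>The constraints of \<open>lot_sizing_set\<close> with periods as indices and a set
  \<open>Z\<close> in place of its 0/1 vector. For \<open>j\<close> in \<open>Z\<close> the demand
  constraint only asks for a nonnegative sum, so it is left out.\<close>

definition feasible ::
  "nat \<Rightarrow> ('m::finite \<Rightarrow> nat \<Rightarrow> real) \<Rightarrow> nat \<Rightarrow> (nat \<Rightarrow> real) \<Rightarrow> (nat \<Rightarrow> real) \<Rightarrow> 'm set \<Rightarrow> bool" where
  "feasible n d k X Y Z \<longleftrightarrow>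
     (\<forall>i\<in>{1..n}. X i \<in> {0, 1} \<and> 0 \<le> Y i \<and> Y i \<le> big_M d n i * X i) \<and>
     card Z \<le> k \<and>
     (\<forall>t\<in>{1..n}. \<forall>j. j \<notin> Z \<longrightarrow> cum_demand d j t \<le> (\<Sum>i=1..t. Y i))"

text \<open>Extra production preserves every demand constraint; only the capacity of
  \<open>h\<close> is at stake, and the setup opens it.\<close>

lemma feasible_raise:
  assumes f: "feasible n d k X Y Z" and h: "Y h \<le> y" "y \<le> big_M d n h"
  shows "feasible n d k (X(h := 1)) (Y(h := y)) Z"
proof -
  have "(\<Sum>i=1..t. Y i) \<le> (\<Sum>i=1..t. (Y(h := y)) i)" for t
    using h by (intro sum_mono) auto
  then show ?thesis
    using f h unfolding feasible_def by (fastforce intro: order_trans)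
qed

lemma feasible_insert:
  assumes "feasible n d k X Y Z" "card (insert j Z) \<le> k"
  shows "feasible n d k X Y (insert j Z)"
  using assms unfolding feasible_def by blast

definition lot_point ::
  "(nat \<Rightarrow> 'n::finite) \<Rightarrow> nat \<Rightarrow> (nat \<Rightarrow> real) \<Rightarrow> (nat \<Rightarrow> real) \<Rightarrow> 'm::finite set \<Rightarrow>
    (real^'n) \<times> (real^'n) \<times> (real^'m)" where
  "lot_point per n X Y Z =
     (\<chi> u. X (inv_into {1..n} per u), \<chi> u. Y (inv_into {1..n} per u), \<chi> j. if j \<in> Z then 1 else 0)"

lemma lot_point_mem:
  assumes per: "bij_betw per {1..n} UNIV" and f: "feasible n d k X Y Z"
  shows "lot_point per n X Y Z \<in> lot_sizing_set per n d k"
proof -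
  have inv: "inv_into {1..n} per (per i) = i" if "i \<in> {1..n}" for i
    using per that by (simp add: bij_betw_inv_into_left)
  have Y: "(\<Sum>i=1..t. Y (inv_into {1..n} per (per i))) = (\<Sum>i=1..t. Y i)" if "t \<le> n" for t
  proof (rule sum.cong)
    fix i assume "i \<in> {1..t}"
    then show "Y (inv_into {1..n} per (per i)) = Y i"
      using that by (subst inv) auto
  qed simp
  \<comment> \<open>This settles the demand constraints of the scenarios in \<open>Z\<close>, whose
    right-hand side is zero.\<close>
  have "0 \<le> (\<Sum>i=1..t. Y i)" if "t \<le> n" for t
    using f that by (intro sum_nonneg) (auto simp: feasible_def)
  then show ?thesis
    using f unfolding lot_point_def lot_sizing_set_def feasible_def cum_demand_def
    by (auto simp: inv Y sum.If_cases simp del: One_nat_def)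
qed

section \<open>The inequality and its coefficients\<close>

locale mixing_facet = positive_demand d n
  for d :: "'m::finite \<Rightarrow> nat \<Rightarrow> real" and n :: nat +
  fixes l k :: nat
    and \<sigma> t :: "nat \<Rightarrow> nat \<Rightarrow> 'm"
    and T :: "nat \<Rightarrow> 'm set"
    and a :: "nat \<Rightarrow> nat"
    and S Sbar :: "nat set"
    and Tbar :: "'m set"
  assumes k_less: "k < CARD('m)"
    and sigma: "\<forall>i\<in>{1..n}. demand_ordering d i (\<sigma> i)"
    and l: "l \<in> {1..n}"
    and S: "S \<subseteq> {1..l}"
    and Sbar: "Sbar = {1..l} - S"
    and T: "\<forall>i\<in>(Sbar - {1}) \<union> {l + 1}.
              T (i - 1) \<subseteq> top_scenarios \<sigma> k (i - 1) \<and>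
              bij_betw (t (i - 1)) {1..a (i - 1)} (T (i - 1)) \<and>
              antimono_on {1..a (i - 1)} (\<lambda>p. cum_demand d (t (i - 1) p) (i - 1)) \<and>
              t (i - 1) (a (i - 1) + 1) = \<sigma> (i - 1) (k + 1)"
    and t_l: "t l 1 = \<sigma> l 1"
    and Tbar: "Tbar = (\<Union>i\<in>Sbar. T (i - 1)) \<union> T l"
    and cond1: "Sbar \<noteq> {}" "1 \<in> S"
    and cond2a: "\<forall>p\<in>Sbar. \<forall>q\<in>Sbar. p \<noteq> q \<longrightarrow> T (p - 1) \<inter> top_scenarios \<sigma> k (q - 1) = {}"
    and cond2b: "\<forall>p\<in>Sbar. T (p - 1) \<inter> top_scenarios \<sigma> k l = {}"
    and cond2c: "\<forall>q\<in>Sbar. T l \<inter> top_scenarios \<sigma> k (q - 1) = {}"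
    and cond3: "\<forall>i\<in>Sbar. cum_demand d (t l 1) l
                  - cum_demand d (t (i - 1) (a (i - 1) + 1)) (i - 1) < big_M d n i"
begin

text \<open>Index \<open>l + 1\<close> stands for the case that no period of \<open>Sbar\<close> has a setup; it then behaves
  like the elements of \<open>Sbar\<close>, with setup coefficient \<open>0\<close>.\<close>

definition I :: "nat set" where "I = insert (l + 1) Sbar"

text \<open>The index is shifted: \<open>C i\<close> belongs to period \<open>i - 1\<close>, so that
  \<open>C (l + 1) 1\<close> is the right-hand side \<open>D\<close> of the inequality.\<close>

definition C :: "nat \<Rightarrow> nat \<Rightarrow> real" where
  "C i p = cum_demand d (t (i - 1) p) (i - 1)"

definition cut :: "nat \<Rightarrow> nat \<Rightarrow> 'm set" where
  "cut i = scenario_selection.cut (\<lambda>j. cum_demand d j (i - 1)) (\<sigma> (i - 1)) k (t (i - 1))"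

abbreviation D :: real where "D \<equiv> C (l + 1) 1"

abbreviation abar :: "'m \<Rightarrow> real" where "abar \<equiv> alpha_bar d T a t Sbar l"

definition lhs :: "(nat \<Rightarrow> real) \<Rightarrow> (nat \<Rightarrow> real) \<Rightarrow> 'm set \<Rightarrow> real" where
  "lhs X Y Z = (\<Sum>i\<in>S. Y i) + (\<Sum>i\<in>Sbar. (D - C i 1) * X i) + (\<Sum>j\<in>Tbar \<inter> Z. abar j)"

lemma finite_S: "finite S" "finite Sbar"
  using S Sbar finite_subset by auto

lemma Sbar_range:
  assumes "i \<in> Sbar"
  shows "2 \<le> i" "i \<le> l" "i \<notin> S"
proof -
  have "i \<noteq> 1"
    using assms Sbar cond1(2) by blast
  then show "2 \<le> i" "i \<le> l" "i \<notin> S"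
    using assms Sbar by auto
qed

lemma I_range:
  assumes "i \<in> I"
  shows "2 \<le> i" "i \<le> l + 1" "i \<notin> S"
  using assms Sbar_range[of i] l S by (auto simp: I_def)

lemma selection:
  assumes "i \<in> I"
  shows "scenario_selection (\<lambda>j. cum_demand d j (i - 1)) (\<sigma> (i - 1)) k (a (i - 1)) (T (i - 1)) (t (i - 1))"
proof -
  have "i - 1 \<in> {1..n}"
    using I_range[OF assms] l by auto
  then have "demand_ordering d (i - 1) (\<sigma> (i - 1))"
    using sigma by blast
  moreover have "i \<in> (Sbar - {1}) \<union> {l + 1}"
    using assms I_range[OF assms] by (auto simp: I_def)
  ultimately show ?thesis
    using T k_less unfolding demand_ordering_def top_scenarios_def scenario_selection_def by blast
qed

lemma C_anti:
  assumes "i \<in> I" "1 \<le> p" "p \<le> q" "q \<le> a (i - 1) + 1"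
  shows "C i q \<le> C i p"
  using scenario_selection.C_t_anti[OF selection[OF assms(1)]] assms(2-) unfolding C_def by blast

lemma cut_sub: "i \<in> I \<Longrightarrow> q \<le> a (i - 1) \<Longrightarrow> cut i q \<subseteq> top_scenarios \<sigma> k (i - 1)"
  unfolding cut_def top_scenarios_def by (rule scenario_selection.cut_sub[OF selection])

lemma card_cut: "i \<in> I \<Longrightarrow> q \<le> a (i - 1) \<Longrightarrow> card (cut i q) \<le> k"
  unfolding cut_def by (rule scenario_selection.card_cut[OF selection])

lemma cut_le:
  "i \<in> I \<Longrightarrow> q \<le> a (i - 1) \<Longrightarrow> j \<notin> cut i q \<Longrightarrow> cum_demand d j (i - 1) \<le> C i (q + 1)"
  unfolding cut_def C_def by (rule scenario_selection.C_le_cut[OF selection])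

lemma T_sub: "i \<in> I \<Longrightarrow> T (i - 1) \<subseteq> top_scenarios \<sigma> k (i - 1)"
  using scenario_selection.U_sub[OF selection] unfolding top_scenarios_def .

lemma bij_t: "i \<in> I \<Longrightarrow> bij_betw (t (i - 1)) {1..a (i - 1)} (T (i - 1))"
  using scenario_selection.bij_t[OF selection] .

text \<open>With \<open>l + 1\<close> counted in \<open>I\<close>, the three parts of condition (2)
  merge into one.\<close>

lemma T_disjoint:
  assumes "i \<in> I" "i' \<in> I" "i \<noteq> i'"
  shows "T (i - 1) \<inter> top_scenarios \<sigma> k (i' - 1) = {}"
  using assms cond2a cond2b cond2c unfolding I_def by (elim insertE; force)

lemma Tbar_I: "Tbar = (\<Union>i\<in>I. T (i - 1))"
  by (auto simp: Tbar I_def)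

text \<open>The cut consists of top scenarios at \<open>i - 1\<close>, which avoid the sets
  \<open>T\<close> of all other indices. The inequality therefore charges only for
  \<open>t (i - 1) 1\<close> to \<open>t (i - 1) q\<close>.\<close>

lemma Tbar_cut:
  assumes "i \<in> I" "q \<le> a (i - 1)"
  shows "Tbar \<inter> cut i q = t (i - 1) ` {1..q}"
proof -
  have "cut i q \<inter> T (i - 1) = t (i - 1) ` {1..q}"
    unfolding cut_def by (rule scenario_selection.cut_Int[OF selection[OF assms(1)] assms(2)])
  moreover have "cut i q \<inter> T (i' - 1) = {}" if "i' \<in> I" "i' \<noteq> i" for i'
    using T_disjoint[OF that(1) assms(1) that(2)] cut_sub[OF assms] by blast
  ultimately show ?thesis
    using assms(1) unfolding Tbar_I by blast
qed

lemma inj_t: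
  assumes "i \<in> I" "q \<le> a (i - 1)"
  shows "inj_on (t (i - 1)) {1..q}"
  using bij_t[OF assms(1)] assms(2) by (auto simp: bij_betw_def intro: inj_on_subset)

text \<open>By \<open>T_disjoint\<close> a scenario belongs to only one of the sets
  \<open>T\<close>, so \<open>alpha_bar\<close> is the maximum of one nonnegative difference and
  zeros.\<close>

lemma abar_t:
  assumes i: "i \<in> I" and p: "p \<in> {1..a (i - 1)}"
  shows "abar (t (i - 1) p) = C i p - C i (p + 1)"
proof -
  let ?j = "t (i - 1) p"
  have inT: "?j \<in> T (i - 1)"
    using bij_t[OF i] p by (auto simp: bij_betw_def)
  have "inv_into {1..a (i - 1)} (t (i - 1)) ?j = p"
    using inj_t[OF i order_refl] p by (rule inv_into_f_f)
  then have own: "alpha d T a t ?j (i - 1) = C i p - C i (p + 1)"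
    using inT by (simp add: alpha_def C_def)
  have other: "alpha d T a t ?j (i' - 1) = 0" if "i' \<in> I" "i' \<noteq> i" for i'
    using T_disjoint[of i i'] T_sub[of i'] that i inT by (auto simp: alpha_def)
  have nonneg: "0 \<le> C i p - C i (p + 1)"
    using C_anti[OF i, of p "p + 1"] p by simp
  show ?thesis
  proof (cases "i = l + 1")
    case True
    \<comment> \<open>Here the difference is the second argument of the outer \<open>max\<close>;
      the inner maximum runs over zeros.\<close>
    then have "alpha d T a t ?j (i' - 1) = 0" if "i' \<in> Sbar" for i'
      using other[of i'] that Sbar_range[OF that] by (auto simp: I_def)
    then have "(\<lambda>i'. alpha d T a t ?j (i' - 1)) ` Sbar = {0}"
      using cond1(1) by auto
    then show ?thesis
      using own nonneg True by (simp add: alpha_bar_def)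
  next
    case False
    then have iS: "i \<in> Sbar"
      using i by (simp add: I_def)
    have "Max ((\<lambda>i'. alpha d T a t ?j (i' - 1)) ` Sbar) = C i p - C i (p + 1)"
    proof (rule Max_eqI)
      show "C i p - C i (p + 1) \<in> (\<lambda>i'. alpha d T a t ?j (i' - 1)) ` Sbar"
        using iS own by force
      fix y assume "y \<in> (\<lambda>i'. alpha d T a t ?j (i' - 1)) ` Sbar"
      then obtain i' where "i' \<in> Sbar" "y = alpha d T a t ?j (i' - 1)"
        by blast
      then show "y \<le> C i p - C i (p + 1)"
        using own other[of i'] nonneg by (cases "i' = i") (auto simp: I_def)
    qed (use finite_S in auto)
    moreover have "alpha d T a t ?j l = 0"
      using other[of "l + 1"] False by (simp add: I_def)
    ultimately show ?thesis
      using nonneg by (simp add: alpha_bar_def)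
  qed
qed

lemma Tbar_obtain:
  assumes "j \<in> Tbar"
  obtains i p where "i \<in> I" "p \<in> {1..a (i - 1)}" "j = t (i - 1) p"
proof -
  obtain i where i: "i \<in> I" "j \<in> T (i - 1)"
    using assms by (auto simp: Tbar_I)
  then obtain p where "p \<in> {1..a (i - 1)}" "j = t (i - 1) p"
    using bij_t[OF i(1)] unfolding bij_betw_def by blast
  with i show ?thesis
    using that by blast
qed

lemma abar_nonneg:
  assumes "j \<in> Tbar"
  shows "0 \<le> abar j"
proof -
  obtain i p where ip: "i \<in> I" "p \<in> {1..a (i - 1)}" "j = t (i - 1) p"
    using Tbar_obtain[OF assms] .
  then show ?thesis
    using C_anti[of i p "p + 1"] abar_t[of i p] by auto
qed

text \<open>The convention \<open>t l 1 = \<sigma> l 1\<close> puts the scenario of largest demand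
  through \<open>l\<close> in first place.\<close>

lemma D_max: "cum_demand d j l \<le> D"
proof -
  have *: "bij_betw (\<sigma> l) {1..CARD('m)} UNIV"
      "antimono_on {1..CARD('m)} (\<lambda>p. cum_demand d (\<sigma> l p) l)"
    using sigma l unfolding demand_ordering_def by auto
  obtain p where "p \<in> {1..CARD('m)}" "j = \<sigma> l p"
    using *(1) unfolding bij_betw_def by blast
  then show ?thesis
    using monotone_onD[OF *(2), of 1 p] t_l by (auto simp: C_def)
qed

lemma cum_demand_le_D:
  assumes "h \<le> l"
  shows "cum_demand d j h \<le> D"
  using cum_demand_mono[OF assms, of j] D_max[of j] l by auto

text \<open>Period \<open>i\<close> is at most \<open>l\<close> and has positive demand. This is
  what makes the setup coefficients positive.\<close>

lemma C_less_D:
  assumes "i \<in> Sbar"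
  shows "C i p < D"
proof -
  have "C i p < cum_demand d (t (i - 1) p) l"
    unfolding C_def using Sbar_range[OF assms] l by (intro cum_demand_strict) auto
  also have "\<dots> \<le> D"
    by (rule D_max)
  finally show ?thesis .
qed

lemma C_le_D: "i \<in> I \<Longrightarrow> C i p \<le> D"
  using I_range[of i] unfolding C_def[of i] by (intro cum_demand_le_D) auto

lemma C_nonneg:
  assumes "i \<in> I"
  shows "0 \<le> C i p"
proof -
  have "cum_demand d (t (i - 1) p) 0 \<le> C i p"
    unfolding C_def using I_range[OF assms] l by (intro cum_demand_mono) auto
  then show ?thesis
    by (simp add: cum_demand_def)
qed

lemma D_le_big_M: "D \<le> big_M d n 1"
  using cum_demand_le_big_M[of 1 l] l by (simp add: C_def cum_demand_def)

section \<open>Validity\<close>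

text \<open>Let \<open>i\<close> be the first period of \<open>Sbar\<close> with a setup, or
  \<open>l + 1\<close> if there is none. Before \<open>i\<close> only periods of \<open>S\<close>
  produce, so \<open>selection_bound\<close> at \<open>i - 1\<close> bounds \<open>C i 1\<close> by
  the production and scenario terms; the setup terms supply the missing
  \<open>D - C i 1\<close>.\<close>

lemma lhs_valid:
  assumes Y: "\<And>i. i \<in> {1..n} \<Longrightarrow> 0 \<le> Y i \<and> Y i \<le> big_M d n i * X i"
    and X: "\<And>i. i \<in> {1..n} \<Longrightarrow> X i \<in> {0, 1}"
    and card: "card Z \<le> k"
    and meet: "\<And>h j. h \<in> {1..n} \<Longrightarrow> j \<notin> Z \<Longrightarrow> cum_demand d j h \<le> (\<Sum>i=1..h. Y i)"
  shows "D \<le> lhs X Y Z"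
proof -
  define i where "i = (LEAST i. i \<in> insert (l + 1) {i \<in> Sbar. X i = 1})"
  have "i \<in> insert (l + 1) {i \<in> Sbar. X i = 1}"
    unfolding i_def by (rule LeastI[of _ "l + 1"]) simp
  then have iI: "i \<in> I" and iX: "i \<noteq> l + 1 \<Longrightarrow> i \<in> Sbar \<and> X i = 1"
    by (auto simp: I_def)
  have before: "X h = 0" if "h \<in> Sbar" "h < i" for h
    using not_less_Least[of h "\<lambda>i. i \<in> insert (l + 1) {i \<in> Sbar. X i = 1}"] that X[of h]
      Sbar_range[of h] l unfolding i_def by auto
  have "(\<Sum>h=1..i-1. Y h) = (\<Sum>h\<in>S \<inter> {1..i-1}. Y h)"
  proof (rule sum.mono_neutral_right)
    show "\<forall>h\<in>{1..i-1} - S \<inter> {1..i-1}. Y h = 0"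
    proof
      fix h assume h: "h \<in> {1..i-1} - S \<inter> {1..i-1}"
      then have "h \<in> Sbar" "h < i"
        using Sbar I_range[OF iI] by auto
      then show "Y h = 0"
        using before[of h] Y[of h] Sbar_range[of h] l by auto
    qed
  qed auto
  also have "\<dots> \<le> (\<Sum>h\<in>S. Y h)"
    using S l Y finite_S by (intro sum_mono2) auto
  finally have sumY: "(\<Sum>h=1..i-1. Y h) \<le> (\<Sum>h\<in>S. Y h)" .
  have "cum_demand d j (i - 1) \<le> (\<Sum>h=1..i-1. Y h)" if "j \<notin> Z" for j
    using I_range[OF iI] l that by (intro meet) auto
  from scenario_selection.selection_bound[OF selection[OF iI] card this]
  have sel: "C i 1 \<le> (\<Sum>h=1..i-1. Y h) +
      (\<Sum>p\<in>{p\<in>{1..a (i-1)}. t (i-1) p \<in> Z}. C i p - C i (p + 1))"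
    unfolding C_def by simp
  have "(\<Sum>p\<in>{p\<in>{1..a (i-1)}. t (i-1) p \<in> Z}. C i p - C i (p + 1)) =
      (\<Sum>j\<in>t (i-1) ` {p\<in>{1..a (i-1)}. t (i-1) p \<in> Z}. abar j)"
    using abar_t[OF iI]
    by (intro sum.reindex_cong[OF inj_on_subset[OF inj_t[OF iI order_refl]], symmetric]) auto
  also have "\<dots> \<le> (\<Sum>j\<in>Tbar \<inter> Z. abar j)"
  proof (rule sum_mono2)
    have "t (i - 1) ` {1..a (i - 1)} \<subseteq> Tbar"
      using bij_t[OF iI] iI unfolding Tbar_I bij_betw_def by blast
    then show "t (i - 1) ` {p \<in> {1..a (i - 1)}. t (i - 1) p \<in> Z} \<subseteq> Tbar \<inter> Z"
      by blast
  qed (auto intro: abar_nonneg)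
  finally have sumZ: "(\<Sum>p\<in>{p\<in>{1..a (i-1)}. t (i-1) p \<in> Z}. C i p - C i (p + 1)) \<le>
      (\<Sum>j\<in>Tbar \<inter> Z. abar j)" .
  have term_nonneg: "0 \<le> (D - C h 1) * X h" if "h \<in> Sbar" for h
    using C_less_D[OF that, of 1] X[of h] Sbar_range[OF that] l by auto
  \<comment> \<open>For \<open>i = l + 1\<close> the left side is zero; otherwise it is one term of
    a nonnegative sum.\<close>
  have "D - C i 1 \<le> (\<Sum>h\<in>Sbar. (D - C h 1) * X h)"
  proof (cases "i = l + 1")
    case True
    then show ?thesis
      using term_nonneg by (auto intro: sum_nonneg)
  next
    case False
    then have "(D - C i 1) * X i \<le> (\<Sum>h\<in>Sbar. (D - C h 1) * X h)"
      using iX term_nonneg finite_S by (intro member_le_sum) auto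
    then show ?thesis
      using iX False by simp
  qed
  then show ?thesis
    using sumY sel sumZ unfolding lhs_def by linarith
qed

section \<open>Tight points and a point off the face\<close>

text \<open>If \<open>l = n\<close>, the index \<open>l + 1\<close> lies beyond the horizon. An
  entry there enters neither \<open>feasible\<close> nor \<open>lhs\<close>, so the same formulas
  serve both cases.\<close>

abbreviation baseX :: "nat \<Rightarrow> nat \<Rightarrow> real" where
  "baseX i \<equiv> (\<lambda>_. 0)(1 := 1, i := 1)"

abbreviation baseY :: "nat \<Rightarrow> nat \<Rightarrow> nat \<Rightarrow> real" where
  "baseY i q \<equiv> (\<lambda>_. 0)(1 := C i (q + 1), i := big_M d n i)"

text \<open>By the choice of \<open>cut\<close>, production in period 1 alone meets the kept
  scenarios through \<open>i - 1\<close>; from \<open>i\<close> on, \<open>big_M d n i\<close>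
  covers the rest.\<close>

lemma base_feasible:
  assumes i: "i \<in> I" and q: "q \<le> a (i - 1)"
  shows "feasible n d k (baseX i) (baseY i q) (cut i q)"
proof -
  note r = I_range[OF i]
  have "cum_demand d j h \<le> (\<Sum>p=1..h. baseY i q p)" if "h \<in> {1..n}" "j \<notin> cut i q" for h j
  proof (cases "i \<le> h")
    case True
    have "cum_demand d j h \<le> cum_demand d j (i - 1) + big_M d n i"
      using True r that by (intro cum_demand_le_big_M) auto
    then show ?thesis
      using cut_le[OF i q that(2)] True r that by (simp add: sum_fun_upd)
  next
    case False
    have "cum_demand d j h \<le> cum_demand d j (i - 1)"
      using False r l by (intro cum_demand_mono) auto
    then show ?thesis
      using cut_le[OF i q that(2)] False r that by (simp add: sum_fun_upd)
  qed
  then show ?thesis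
    using card_cut[OF i q] r C_nonneg[OF i, of "q + 1"] big_M_nonneg[of i]
      C_le_D[OF i, of "q + 1"] D_le_big_M
    by (auto simp: feasible_def)
qed

text \<open>The scenario terms telescope to \<open>C i 1 - C i (q + 1)\<close>, production in period
  1 adds \<open>C i (q + 1)\<close>, and the setup term adds \<open>D - C i 1\<close>, which is zero
  for \<open>i = l + 1\<close>.\<close>

lemma base_tight:
  assumes i: "i \<in> I" and q: "q \<le> a (i - 1)"
  shows "lhs (baseX i) (baseY i q) (cut i q) = D"
proof -
  note r = I_range[OF i]
  have "(\<Sum>j\<in>Tbar \<inter> cut i q. abar j) = (\<Sum>p=1..q. abar (t (i - 1) p))"
    unfolding Tbar_cut[OF i q] by (rule sum.reindex_cong[OF inj_t[OF i q]]) auto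
  also have "\<dots> = (\<Sum>p=1..q. C i p - C i (p + 1))"
    using abar_t[OF i] q by (intro sum.cong) auto
  also have "\<dots> = C i 1 - C i (q + 1)"
    by (rule sum_diff_Suc)
  finally have Z: "(\<Sum>j\<in>Tbar \<inter> cut i q. abar j) = C i 1 - C i (q + 1)" .
  have "1 \<notin> Sbar"
    using cond1 Sbar by auto
  then have "(\<Sum>h\<in>Sbar. (D - C h 1) * baseX i h) = D - C i 1"
    unfolding sum_fun_upd_weighted[OF finite_S(2)] using i r by (auto simp: I_def)
  then show ?thesis
    using Z r cond1 finite_S by (simp add: lhs_def sum_fun_upd)
qed

text \<open>No scenario exceeds \<open>D\<close>. This base point thus leaves the whole budget
  \<open>k\<close> for giving up further scenarios.\<close>

lemma cut_empty: "cut (l + 1) 0 = {}"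
proof -
  have "cut (l + 1) 0 = {j \<in> \<sigma> l ` {1..k}. D < cum_demand d j l}"
    using scenario_selection.cut_def[OF selection[of "l + 1"], of 0]
    by (simp add: cut_def C_def I_def)
  then show ?thesis
    using D_max by (auto simp: not_less)
qed

lemma lhs_upd_X:
  assumes "h \<notin> Sbar"
  shows "lhs (X(h := x)) Y Z = lhs X Y Z"
  unfolding lhs_def sum_fun_upd_weighted[OF finite_S(2)] using assms by simp

lemma lhs_upd_Y: "lhs X (Y(h := y)) Z = lhs X Y Z + (if h \<in> S then y - Y h else 0)"
  by (simp add: lhs_def sum_fun_upd finite_S)

text \<open>Shows that the face is proper: period 1 alone supplies at least \<open>D\<close>, and
  the setups in the nonempty \<open>Sbar\<close> have positive coefficients.\<close>

lemma slack_point: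
  "feasible n d k (\<lambda>_. 1) ((\<lambda>_. 0)(1 := big_M d n 1)) {}"
  "D < lhs (\<lambda>_. 1) ((\<lambda>_. 0)(1 := big_M d n 1)) {}"
proof -
  have "cum_demand d j h \<le> big_M d n 1" if "h \<in> {1..n}" for h j
    using cum_demand_le_big_M[of 1 h j] that by (simp add: cum_demand_def)
  then show "feasible n d k (\<lambda>_. 1) ((\<lambda>_. 0)(1 := big_M d n 1)) {}"
    using big_M_nonneg by (auto simp: feasible_def sum_fun_upd)
  have "0 < (\<Sum>i\<in>Sbar. D - C i 1)"
    using finite_S cond1(1) C_less_D by (intro sum_pos) auto
  then show "D < lhs (\<lambda>_. 1) ((\<lambda>_. 0)(1 := big_M d n 1)) {}"
    using D_le_big_M cond1(2) finite_S by (simp add: lhs_def sum_fun_upd)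
qed

end

section \<open>Functionals that are constant on the tight points\<close>

text \<open>\<open>\<gamma>\<close>, \<open>\<pi>\<close> and \<open>\<zeta>\<close> are the
  coefficients of setups, production and given up scenarios. By \<open>supp\<close> the first two
  vanish beyond the horizon, so changes at \<open>l + 1\<close> need no separate case for
  \<open>l = n\<close>.\<close>

locale tight_functional = mixing_facet +
  fixes \<gamma> \<pi> :: "nat \<Rightarrow> real" and \<zeta> :: "'a \<Rightarrow> real" and c :: real
  assumes supp: "h \<notin> {1..n} \<Longrightarrow> \<gamma> h = 0 \<and> \<pi> h = 0"
    and const: "\<lbrakk>feasible n d k X Y Z; lhs X Y Z = D\<rbrakk> \<Longrightarrow>
      (\<Sum>i=1..n. \<gamma> i * X i) + (\<Sum>i=1..n. \<pi> i * Y i) + (\<Sum>j\<in>Z. \<zeta> j) = c"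
begin

definition val :: "(nat \<Rightarrow> real) \<Rightarrow> (nat \<Rightarrow> real) \<Rightarrow> 'a set \<Rightarrow> real" where
  "val X Y Z = (\<Sum>i=1..n. \<gamma> i * X i) + (\<Sum>i=1..n. \<pi> i * Y i) + (\<Sum>j\<in>Z. \<zeta> j)"

lemma val_tight: "feasible n d k X Y Z \<Longrightarrow> lhs X Y Z = D \<Longrightarrow> val X Y Z = c"
  unfolding val_def by (rule const)

lemma val_upd_X: "val (X(h := x)) Y Z = val X Y Z + \<gamma> h * (x - X h)"
  using supp[of h] unfolding val_def sum_fun_upd_weighted[OF finite_atLeastAtMost] by auto

lemma val_upd_Y: "val X (Y(h := y)) Z = val X Y Z + \<pi> h * (y - Y h)"
  using supp[of h] unfolding val_def sum_fun_upd_weighted[OF finite_atLeastAtMost] by auto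

lemma val_zero: "val (\<lambda>_. 0) (\<lambda>_. 0) Z = (\<Sum>j\<in>Z. \<zeta> j)"
  by (simp add: val_def)

lemma val_base:
  assumes "i \<in> I" "q \<le> a (i - 1)"
  shows "\<gamma> 1 + \<gamma> i + \<pi> 1 * C i (q + 1) + \<pi> i * big_M d n i + (\<Sum>j\<in>cut i q. \<zeta> j) = c"
  using val_tight[OF base_feasible[OF assms] base_tight[OF assms]] I_range[OF assms(1)]
  by (simp add: val_upd_X val_upd_Y val_zero)

text \<open>Period \<open>h\<close> is idle in the base point. A setup outside \<open>Sbar\<close>
  costs nothing in the inequality, nor does production outside \<open>S\<close>, so the raised point
  is tight as well and the two values agree.\<close>

lemma raise_coeffs:
  assumes i: "i \<in> I" and h: "h \<notin> insert 1 Sbar" "h \<noteq> i"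
    and y: "0 \<le> y" "y \<le> big_M d n h" "h \<in> S \<Longrightarrow> y = 0"
  shows "\<gamma> h + \<pi> h * y = 0"
proof -
  have "h \<notin> Sbar"
    using h by simp
  note raise = feasible_raise[OF base_feasible[OF i, of 0], of h y]
    lhs_upd_X[OF this, of "baseX i" 1 "(baseY i 0)(h := y)" "cut i 0"]
    lhs_upd_Y[of "baseX i" "baseY i 0" h y "cut i 0"]
    val_upd_X[of "baseX i" h 1 "(baseY i 0)(h := y)" "cut i 0"]
    val_upd_Y[of "baseX i" "baseY i 0" h y "cut i 0"]
  have at_h: "baseX i h = 0" "baseY i 0 h = 0"
    using h by auto
  have base: "lhs (baseX i) (baseY i 0) (cut i 0) = D"
    by (intro base_tight i) auto
  then have "lhs ((baseX i)(h := 1)) ((baseY i 0)(h := y)) (cut i 0) = D"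
    using y(3) unfolding raise(2,3) at_h by (cases "h \<in> S") auto
  then have "val ((baseX i)(h := 1)) ((baseY i 0)(h := y)) (cut i 0) = c"
    using raise(1) y(1,2) unfolding at_h by (intro val_tight) auto
  moreover have "val (baseX i) (baseY i 0) (cut i 0) = c"
    using base by (intro val_tight base_feasible i) auto
  ultimately show ?thesis
    unfolding raise(4,5) at_h by simp
qed

lemma \<gamma>_zero:
  assumes h: "h \<notin> insert 1 Sbar"
  shows "\<gamma> h = 0"
proof (cases "h \<in> {1..n}")
  case True
  \<comment> \<open>An index from \<open>Sbar\<close> differs from every admissible
    \<open>h\<close>, including \<open>l + 1\<close>.\<close>
  obtain i where "i \<in> Sbar" "i \<in> I"
    using cond1(1) by (auto simp: I_def)
  then show ?thesis
    using raise_coeffs[of i h 0] big_M_nonneg[of h] True h by auto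
qed (use supp in auto)

text \<open>Production after \<open>l\<close> is free in the inequality, so a positive amount can be
  added; the setup coefficient is already zero.\<close>

lemma \<pi>_late:
  assumes h: "l < h"
  shows "\<pi> h = 0"
proof (cases "h \<in> {1..n}")
  case True
  obtain i where i: "i \<in> Sbar" "i \<in> I"
    using cond1(1) by (auto simp: I_def)
  have h': "h \<notin> insert 1 Sbar" "h \<noteq> i" "h \<notin> S"
    using h Sbar_range(2)[OF i(1)] Sbar_range(2)[of h] S l by auto
  have "0 < big_M d n h"
    using demand_le_big_M[OF True] demand_pos[OF True] by (rule less_le_trans[rotated])
  then show ?thesis
    using raise_coeffs[OF i(2) h'(1,2), of "big_M d n h"] \<gamma>_zero[OF h'(1)] h'(3) by simp
qed (use supp in auto)

text \<open>Two tight points differ only in the amount produced in \<open>i\<close>: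
  \<open>big_M d n i\<close> or \<open>D - C i 1\<close>. Condition (3) makes these
  distinct.\<close>

lemma \<pi>_Sbar:
  assumes i: "i \<in> Sbar"
  shows "\<pi> i = 0"
proof -
  have iI: "i \<in> I"
    using i by (simp add: I_def)
  note r = Sbar_range[OF i]
  let ?X = "(baseX i)(l + 1 := 1)" and ?Z = "cut i 0"
  \<comment> \<open>Production at \<open>l + 1\<close> covers the demand after \<open>l\<close> once
    the amount in \<open>i\<close> is lowered.\<close>
  let ?Y = "(baseY i 0)(l + 1 := big_M d n (l + 1))"
  have "l + 1 \<notin> Sbar" "l + 1 \<notin> S"
    using S Sbar_range(2)[of "l + 1"] by auto
  then have tight: "lhs ?X ?Y ?Z = D"
    using base_tight[OF iI, of 0] lhs_upd_X[of "l + 1" "baseX i" 1 ?Y ?Z]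
      lhs_upd_Y[of "baseX i" "baseY i 0" "l + 1" _ ?Z] by simp
  have "feasible n d k ?X ?Y ?Z"
    using big_M_nonneg[of "l + 1"] r l by (intro feasible_raise base_feasible iI) auto
  then have val1: "val ?X ?Y ?Z = c"
    using tight by (rule val_tight)
  \<comment> \<open>Condition (3) speaks of the sentinel, whose value is at most
    \<open>C i 1\<close>.\<close>
  have "C i (a (i - 1) + 1) \<le> C i 1"
    using C_anti[OF iI, of 1 "a (i - 1) + 1"] by simp
  then have less: "D - C i 1 < big_M d n i"
    using cond3 i by (fastforce simp: C_def)
  \<comment> \<open>The lowered plan has produced \<open>C i 1\<close> before \<open>i\<close>,
    \<open>D\<close> from \<open>i\<close> through \<open>l\<close>, and
    \<open>D + big_M d n (l + 1)\<close> afterwards.\<close>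
  have "cum_demand d j h \<le> (\<Sum>p=1..h. (?Y(i := D - C i 1)) p)"
    if h: "h \<in> {1..n}" and j: "j \<notin> ?Z" for h j
  proof -
    consider "h < i" | "i \<le> h" "h \<le> l" | "l < h"
      by linarith
    then show ?thesis
    proof cases
      case 1
      then have "cum_demand d j h \<le> cum_demand d j (i - 1)"
        using r l by (intro cum_demand_mono) auto
      then show ?thesis
        using cut_le[OF iI _ j] 1 r h by (simp add: sum_fun_upd)
    next
      case 2
      then show ?thesis
        using cum_demand_le_D[of h j] r h by (simp add: sum_fun_upd)
    next
      case 3
      then have "cum_demand d j h \<le> cum_demand d j l + big_M d n (l + 1)"
        using cum_demand_le_big_M[of "l + 1" h j] h by simp
      then show ?thesis
        using D_max[of j] 3 r h by (simp add: sum_fun_upd)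
    qed
  qed
  then have "feasible n d k ?X (?Y(i := D - C i 1)) ?Z"
    using card_cut[OF iI, of 0] r C_nonneg[OF iI, of 1] less C_less_D[OF i, of 1]
      D_le_big_M big_M_nonneg[of "l + 1"] l
    by (auto simp: feasible_def)
  moreover have "lhs ?X (?Y(i := D - C i 1)) ?Z = D"
    unfolding lhs_upd_Y[of _ ?Y] using tight r by simp
  ultimately have "val ?X (?Y(i := D - C i 1)) ?Z = c"
    by (rule val_tight)
  then have "\<pi> i * (D - C i 1 - big_M d n i) = 0"
    unfolding val_upd_Y[of _ ?Y] using val1 r by simp
  then show ?thesis
    using less by simp
qed

text \<open>Moving an amount \<open>\<delta>\<close> from period 1 to \<open>h\<close> leaves the
  sum over \<open>S\<close> unchanged, and the new setup has coefficient zero.\<close>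

lemma \<pi>_S:
  assumes h: "h \<in> S"
  shows "\<pi> h = \<pi> 1"
proof (cases "h = 1")
  case False
  then have r: "2 \<le> h" "h \<le> l"
    using h S by auto
  have iI: "l + 1 \<in> I"
    by (simp add: I_def)
  have hS: "h \<notin> Sbar"
    using h Sbar by simp
  \<comment> \<open>The least demand of \<open>h\<close> over all scenarios: positive, and small
    enough that \<open>D - \<delta>\<close> suffices before \<open>h\<close>, when the demand of
    \<open>h\<close> is still to come.\<close>
  define \<delta> where "\<delta> = Min (range (\<lambda>j. d j h))"
  have \<delta>: "\<delta> \<le> d j h" for j
    unfolding \<delta>_def by (rule Min_le) auto
  have \<delta>_pos: "0 < \<delta>"
    unfolding \<delta>_def using r l by (subst Min_gr_iff) (auto intro: demand_pos)
  have \<delta>_M: "\<delta> \<le> big_M d n h"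
    using \<delta>[of undefined] demand_le_big_M[of h undefined] r l by auto
  have \<delta>_D: "\<delta> \<le> D"
  proof -
    have "cum_demand d j 0 + d j h \<le> cum_demand d j l" for j
      using r l by (intro cum_demand_add_le) auto
    then show ?thesis
      using \<delta> D_max unfolding cum_demand_def[of d _ 0] by (fastforce intro: order_trans)
  qed
  let ?X = "baseX (l + 1)" and ?Y = "baseY (l + 1) 0" and ?Z = "cut (l + 1) 0"
  let ?X' = "?X(h := 1)" and ?Y' = "?Y(1 := D - \<delta>, h := \<delta>)"
  have "cum_demand d j p \<le> (\<Sum>i=1..p. ?Y' i)" if p: "p \<in> {1..n}" for p j
  proof -
    consider "p < h" | "h \<le> p" "p \<le> l" | "l < p"
      by linarith
    then show ?thesis
    proof cases
      case 1
      then have "cum_demand d j p + d j h \<le> cum_demand d j l"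
        using r l by (intro cum_demand_add_le) auto
      then show ?thesis
        using \<delta>[of j] D_max[of j] 1 r p by (simp add: sum_fun_upd)
    next
      case 2
      then show ?thesis
        using cum_demand_le_D[of p j] r p by (simp add: sum_fun_upd)
    next
      case 3
      then have "cum_demand d j p \<le> cum_demand d j l + big_M d n (l + 1)"
        using cum_demand_le_big_M[of "l + 1" p j] p by simp
      then show ?thesis
        using D_max[of j] 3 r p by (simp add: sum_fun_upd)
    qed
  qed
  then have "feasible n d k ?X' ?Y' ?Z"
    using card_cut[OF iI, of 0] r \<delta>_pos \<delta>_M \<delta>_D D_le_big_M big_M_nonneg[of "l + 1"] l
    by (auto simp: feasible_def)
  moreover have base: "lhs ?X ?Y ?Z = D"
    by (intro base_tight iI) auto
  have "lhs ?X' ?Y' ?Z = D"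
    unfolding lhs_upd_X[OF hS] lhs_upd_Y[of _ "?Y(1 := D - \<delta>)"] lhs_upd_Y[of _ ?Y] base
    using h cond1(2) r l by simp
  ultimately have "val ?X' ?Y' ?Z = c"
    by (rule val_tight)
  moreover have "val ?X ?Y ?Z = c"
    using base by (intro val_tight base_feasible iI) auto
  ultimately have "\<pi> h * \<delta> = \<pi> 1 * \<delta>"
    unfolding val_upd_X[of ?X] val_upd_Y[of _ "?Y(1 := D - \<delta>)"] val_upd_Y[of _ ?Y]
    using \<gamma>_zero[of h] hS r l by (simp add: algebra_simps)
  then show ?thesis
    using \<delta>_pos by simp
qed simp

lemma \<pi>_eq: "\<pi> h = (if h \<in> S then \<pi> 1 else 0)"
proof (cases "h \<in> {1..l}")
  case True
  then show ?thesis
    using \<pi>_S[of h] \<pi>_Sbar[of h] Sbar by auto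
next
  case False
  then have "l < h \<or> h \<notin> {1..n}"
    using l by auto
  then have "\<pi> h = 0"
    using \<pi>_late supp by blast
  then show ?thesis
    using False S by auto
qed

text \<open>The base point for \<open>l + 1\<close> and \<open>q = 0\<close> gives up nothing, so
  there is room for \<open>j\<close> if \<open>1 \<le> k\<close>; tightness persists since
  \<open>j\<close> has no coefficient.\<close>

lemma \<zeta>_outside:
  assumes "1 \<le> k" "j \<notin> Tbar"
  shows "\<zeta> j = 0"
proof -
  have iI: "l + 1 \<in> I"
    by (simp add: I_def)
  let ?X = "baseX (l + 1)" and ?Y = "baseY (l + 1) 0"
  have base: "feasible n d k ?X ?Y {}" "lhs ?X ?Y {} = D"
    using base_feasible[OF iI, of 0] base_tight[OF iI, of 0] unfolding cut_empty by auto
  have "feasible n d k ?X ?Y {j}"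
    using feasible_insert[OF base(1), of j] assms by simp
  moreover have "lhs ?X ?Y {j} = D"
    using base(2) assms(2) unfolding lhs_def by simp
  ultimately have "val ?X ?Y {j} = val ?X ?Y {}"
    using val_tight base by metis
  then show ?thesis
    by (simp add: val_def)
qed

lemma sum_\<zeta>_cut:
  assumes i: "i \<in> I" and q: "q \<le> a (i - 1)"
  shows "(\<Sum>j\<in>cut i q. \<zeta> j) = (\<Sum>p=1..q. \<zeta> (t (i - 1) p))"
proof -
  have "\<zeta> j = 0" if "j \<in> cut i q - Tbar" for j
  proof -
    \<comment> \<open>A nonempty cut of size at most \<open>k\<close> provides the
      \<open>1 \<le> k\<close> required by \<open>\<zeta>_outside\<close>.\<close>
    have "0 < card (cut i q)"
      using that by (auto simp: card_gt_0_iff)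
    then show ?thesis
      using card_cut[OF i q] that by (intro \<zeta>_outside) auto
  qed
  then have "(\<Sum>j\<in>cut i q. \<zeta> j) = (\<Sum>j\<in>Tbar \<inter> cut i q. \<zeta> j)"
    by (intro sum.mono_neutral_right) auto
  also have "\<dots> = (\<Sum>p=1..q. \<zeta> (t (i - 1) p))"
    unfolding Tbar_cut[OF i q] by (rule sum.reindex_cong[OF inj_t[OF i q]]) auto
  finally show ?thesis .
qed

text \<open>Consecutive base points of the same \<open>i\<close> trade production in period 1 for
  one more scenario of \<open>Tbar\<close>; the rest of their values agrees.\<close>

lemma \<zeta>_Tbar:
  assumes "j \<in> Tbar"
  shows "\<zeta> j = \<pi> 1 * abar j"
proof -
  obtain i p where ip: "i \<in> I" "p \<in> {1..a (i - 1)}" "j = t (i - 1) p"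
    using Tbar_obtain[OF assms] .
  \<comment> \<open>Base points are numbered from zero, positions of \<open>t\<close> from
    one.\<close>
  then obtain q where q: "p = q + 1" "q + 1 \<le> a (i - 1)"
    by (cases p) auto
  have "\<pi> 1 * C i (q + 1) = \<pi> 1 * C i (q + 1 + 1) + \<zeta> (t (i - 1) (q + 1))"
    using val_base[OF ip(1), of q] val_base[OF ip(1), of "q + 1"] q
      sum_\<zeta>_cut[OF ip(1), of q] sum_\<zeta>_cut[OF ip(1), of "q + 1"] by simp
  then show ?thesis
    unfolding ip(3) abar_t[OF ip(1,2)] unfolding q(1) by (simp add: right_diff_distrib)
qed

lemma c_eq: "c = \<gamma> 1 + \<pi> 1 * D"
proof -
  have "l + 1 \<notin> insert 1 Sbar" "l + 1 \<notin> S"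
    using Sbar_range(2)[of "l + 1"] S l by auto
  then show ?thesis
    using val_base[of "l + 1" 0] \<gamma>_zero[of "l + 1"] \<pi>_eq[of "l + 1"] cut_empty
    by (simp add: I_def)
qed

text \<open>The base points with \<open>q = 0\<close> for \<open>i\<close> and for
  \<open>l + 1\<close> have the same value; the latter gives \<open>c_eq\<close>.\<close>

lemma \<gamma>_Sbar:
  assumes "i \<in> Sbar"
  shows "\<gamma> i = \<pi> 1 * (D - C i 1)"
proof -
  have i: "i \<in> I"
    using assms by (simp add: I_def)
  have "\<gamma> 1 + \<gamma> i + \<pi> 1 * C i 1 = c"
    using val_base[OF i, of 0] sum_\<zeta>_cut[OF i, of 0] \<pi>_Sbar[OF assms] by simp
  then show ?thesis
    using c_eq by (simp add: algebra_simps)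
qed

text \<open>The undetermined \<open>\<gamma> 1\<close> cancels against \<open>c\<close> because
  \<open>X 1 = 1\<close>. If \<open>k = 0\<close>, \<open>\<zeta>\<close> is undetermined outside
  \<open>Tbar\<close>, but there \<open>z\<close> vanishes.\<close>

lemma functional_eq:
  fixes X Y :: "nat \<Rightarrow> real" and z :: "'a \<Rightarrow> real"
  assumes X1: "X 1 = 1" and z: "k = 0 \<Longrightarrow> z = (\<lambda>_. 0)"
  shows "(\<Sum>i=1..n. \<gamma> i * X i) + (\<Sum>i=1..n. \<pi> i * Y i) + (\<Sum>j\<in>UNIV. \<zeta> j * z j) - c =
    \<pi> 1 * ((\<Sum>i\<in>S. Y i) + (\<Sum>i\<in>Sbar. (D - C i 1) * X i) + (\<Sum>j\<in>Tbar. abar j * z j) - D)"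
proof -
  have sub: "S \<subseteq> {1..n}" "insert 1 Sbar \<subseteq> {1..n}" "1 \<notin> Sbar"
    using S Sbar l cond1(2) by auto
  have "(\<Sum>i=1..n. \<gamma> i * X i) = (\<Sum>i\<in>insert 1 Sbar. \<gamma> i * X i)"
    using sub(2) \<gamma>_zero by (intro sum.mono_neutral_right) auto
  also have "\<dots> = \<gamma> 1 + (\<Sum>i\<in>Sbar. \<gamma> i * X i)"
    using sub(3) finite_S X1 by simp
  also have "(\<Sum>i\<in>Sbar. \<gamma> i * X i) = \<pi> 1 * (\<Sum>i\<in>Sbar. (D - C i 1) * X i)"
    unfolding sum_distrib_left by (intro sum.cong) (auto simp: \<gamma>_Sbar)
  finally have x: "(\<Sum>i=1..n. \<gamma> i * X i) = \<gamma> 1 + \<pi> 1 * (\<Sum>i\<in>Sbar. (D - C i 1) * X i)" .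
  have "(\<Sum>i=1..n. \<pi> i * Y i) = (\<Sum>i\<in>S. \<pi> i * Y i)"
    using sub(1) \<pi>_eq by (intro sum.mono_neutral_right) auto
  also have "\<dots> = \<pi> 1 * (\<Sum>i\<in>S. Y i)"
    unfolding sum_distrib_left by (intro sum.cong) (auto simp: \<pi>_S)
  finally have y: "(\<Sum>i=1..n. \<pi> i * Y i) = \<pi> 1 * (\<Sum>i\<in>S. Y i)" .
  have "\<zeta> j * z j = 0" if "j \<notin> Tbar" for j
    using \<zeta>_outside[of j] z that by (cases "k = 0") auto
  then have "(\<Sum>j\<in>UNIV. \<zeta> j * z j) = (\<Sum>j\<in>Tbar. \<zeta> j * z j)"
    by (intro sum.mono_neutral_right) auto
  also have "\<dots> = \<pi> 1 * (\<Sum>j\<in>Tbar. abar j * z j)"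
    unfolding sum_distrib_left by (intro sum.cong) (auto simp: \<zeta>_Tbar)
  finally show ?thesis
    unfolding x y c_eq by (simp add: algebra_simps)
qed

end

section \<open>Transfer to coordinates and conclusion\<close>

theorem proposition3:
  fixes per :: "nat \<Rightarrow> 'n::finite"
    and n l k :: nat
    and d :: "'m::finite \<Rightarrow> nat \<Rightarrow> real"
    and \<epsilon> :: real
    and \<sigma> t :: "nat \<Rightarrow> nat \<Rightarrow> 'm"
    and T :: "nat \<Rightarrow> 'm set"
    and a :: "nat \<Rightarrow> nat"
    and S Sbar :: "nat set"
    and Tbar :: "'m set"
  assumes per: "bij_betw per {1..n} (UNIV :: 'n set)"
    and eps: "0 \<le> \<epsilon>" "\<epsilon> < 1"
    and k: "k = nat \<lfloor>real CARD('m) * \<epsilon>\<rfloor>"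
    and sigma: "\<forall>i\<in>{1..n}. demand_ordering d i (\<sigma> i)"
    and l: "l \<in> {1..n}"
    and S: "S \<subseteq> {1..l}"
    and Sbar: "Sbar = {1..l} - S"
    and T: "\<forall>i\<in>(Sbar - {1}) \<union> {l + 1}.
              T (i - 1) \<subseteq> top_scenarios \<sigma> k (i - 1) \<and>
              bij_betw (t (i - 1)) {1..a (i - 1)} (T (i - 1)) \<and>
              antimono_on {1..a (i - 1)} (\<lambda>p. cum_demand d (t (i - 1) p) (i - 1)) \<and>
              t (i - 1) (a (i - 1) + 1) = \<sigma> (i - 1) (k + 1)"
    and t_l: "t l 1 = \<sigma> l 1"
    and Tbar: "Tbar = (\<Union>i\<in>Sbar. T (i - 1)) \<union> T l"
    and cond1: "Sbar \<noteq> {}" "1 \<in> S"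
    and cond2a: "\<forall>p\<in>Sbar. \<forall>q\<in>Sbar. p \<noteq> q \<longrightarrow> T (p - 1) \<inter> top_scenarios \<sigma> k (q - 1) = {}"
    and cond2b: "\<forall>p\<in>Sbar. T (p - 1) \<inter> top_scenarios \<sigma> k l = {}"
    and cond2c: "\<forall>q\<in>Sbar. T l \<inter> top_scenarios \<sigma> k (q - 1) = {}"
    and cond3: "\<forall>i\<in>Sbar. cum_demand d (t l 1) l
                  - cum_demand d (t (i - 1) (a (i - 1) + 1)) (i - 1) < big_M d n i"
    and cond4: "\<forall>j. \<forall>i\<in>{1..n}. d j i > 0"
  shows "facet_defining
           (\<lambda>(x, y, z).
              (\<Sum>i\<in>S. y $ per i)
              + (\<Sum>i\<in>Sbar. (cum_demand d (t l 1) l - cum_demand d (t (i - 1) 1) (i - 1)) * x $ per i)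
              + (\<Sum>j\<in>Tbar. alpha_bar d T a t Sbar l j * z $ j))
           (cum_demand d (t l 1) l)
           (convex hull (lot_sizing_set per n d k))"
proof -
  have "real CARD('m) * \<epsilon> < real CARD('m)"
    using eps by simp
  then have kless: "k < CARD('m)"
    unfolding k using eps by (simp add: nat_less_iff floor_less_iff)
  interpret mixing_facet d n l k \<sigma> t T a S Sbar Tbar
    by unfold_locales (use assms kless in auto)
  define f :: "(real^'n) \<times> (real^'n) \<times> (real^'m) \<Rightarrow> real" where
    "f = (\<lambda>(x, y, z). (\<Sum>i\<in>S. y $ per i) + (\<Sum>i\<in>Sbar. (D - C i 1) * x $ per i)
           + (\<Sum>j\<in>Tbar. abar j * z $ j))"
  have f: "f (x, y, z) = (\<Sum>i\<in>S. y $ per i) + (\<Sum>i\<in>Sbar. (D - C i 1) * x $ per i)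
           + (\<Sum>j\<in>Tbar. abar j * z $ j)" for x y z
    by (simp add: f_def)
  let ?P = "lot_sizing_set per n d k"
  have inv: "inv_into {1..n} per (per i) = i" if "i \<in> {1..n}" for i
    using per that by (rule bij_betw_inv_into_left)
  have f_point: "f (lot_point per n X Y Z) = lhs X Y Z" for X Y Z
  proof -
    have "inv_into {1..n} per (per i) = i" if "i \<in> S \<union> Sbar" for i
      using that S Sbar l by (intro inv) auto
    then show ?thesis
      by (auto simp: lot_point_def f lhs_def if_distrib[of "(*) _"] sum.If_cases
          intro!: arg_cong2[of _ _ _ _ "(+)"] sum.cong)
  qed
  have lI: "l + 1 \<in> I"
    by (simp add: I_def)
  have "facet_defining f D (convex hull ?P)"
  proof (rule facet_defining_convex_hullI)
    show "linear f"
      by (rule linearI) (auto simp: f_def sum.distrib sum_distrib_left distrib_left distrib_right mult_ac)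
    show "lot_point per n (baseX (l + 1)) (baseY (l + 1) 0) (cut (l + 1) 0) \<in> ?P"
      by (intro lot_point_mem per base_feasible lI) simp
    show "f (lot_point per n (baseX (l + 1)) (baseY (l + 1) 0) (cut (l + 1) 0)) = D"
      unfolding f_point by (intro base_tight lI) simp
    show "lot_point per n (\<lambda>_. 1) ((\<lambda>_. 0)(1 := big_M d n 1)) {} \<in> ?P"
      by (intro lot_point_mem per slack_point)
    show "f (lot_point per n (\<lambda>_. 1) ((\<lambda>_. 0)(1 := big_M d n 1)) {}) \<noteq> D"
      unfolding f_point using slack_point(2) by simp
  next
    fix v assume "v \<in> ?P"
    obtain x y z where v: "v = (x, y, z)"
      by (cases v)
    \<comment> \<open>\<open>z\<close> is the indicator of this set, which brings the point into the
      form of \<open>lhs_valid\<close>.\<close>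
    define Z where "Z = {j. z $ j = 1}"
    have P: "\<forall>i\<in>{1..n}. x $ per i \<in> {0, 1}" "\<forall>i\<in>{1..n}. 0 \<le> y $ per i"
        "\<forall>t\<in>{1..n}. \<forall>j. (\<Sum>i=1..t. d j i * (1 - z $ j)) \<le> (\<Sum>i=1..t. y $ per i)"
        "(\<Sum>j\<in>UNIV. z $ j) \<le> real k"
        "\<forall>i\<in>{1..n}. y $ per i \<le> big_M d n i * x $ per i"
      and z: "z $ j = (if j \<in> Z then 1 else 0)" for j
      using \<open>v \<in> ?P\<close> by (auto simp: v lot_sizing_set_def Z_def)
    have "card Z \<le> k"
      using P(4) by (simp add: z sum.If_cases)
    moreover have "cum_demand d j h \<le> (\<Sum>i=1..h. y $ per i)" if "h \<in> {1..n}" "j \<notin> Z" for h j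
      using P(3)[rule_format, OF that(1), of j] that(2) by (simp add: cum_demand_def z)
    ultimately have "D \<le> lhs (\<lambda>i. x $ per i) (\<lambda>i. y $ per i) Z"
      using P by (intro lhs_valid) auto
    also have "\<dots> = f v"
      by (simp add: v f lhs_def z if_distrib[of "(*) _"] sum.If_cases)
    finally show "D \<le> f v" .
  next
    fix g :: "(real^'n) \<times> (real^'n) \<times> (real^'m)" and c
    assume g: "\<And>v. v \<in> ?P \<Longrightarrow> f v = D \<Longrightarrow> g \<bullet> v = c"
    obtain gx gy gz where g_eq: "g = (gx, gy, gz)"
      by (cases g)
    \<comment> \<open>Coefficients are indexed by periods, with default zero beyond the horizon as
      \<open>supp\<close> demands.\<close>
    define \<gamma> where "\<gamma> i = (if i \<in> {1..n} then gx $ per i else 0)" for i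
    define \<pi> where "\<pi> i = (if i \<in> {1..n} then gy $ per i else 0)" for i
    have inner: "g \<bullet> (x, y, z) = (\<Sum>i=1..n. \<gamma> i * x $ per i) + (\<Sum>i=1..n. \<pi> i * y $ per i)
        + (\<Sum>j\<in>UNIV. gz $ j * z $ j)" for x y z
      by (simp add: g_eq inner_vec_def \<gamma>_def \<pi>_def flip: sum.reindex_bij_betw[OF per])
    interpret tight_functional d n l k \<sigma> t T a S Sbar Tbar \<gamma> \<pi> "\<lambda>j. gz $ j" c
    proof unfold_locales
      fix X Y Z
      assume "feasible n d k X Y Z" "lhs X Y Z = D"
      then have "g \<bullet> lot_point per n X Y Z = c"
        by (intro g lot_point_mem per) (simp_all add: f_point)
      moreover have "(\<Sum>i=1..n. \<gamma> i * X (inv_into {1..n} per (per i))) = (\<Sum>i=1..n. \<gamma> i * X i)"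
          "(\<Sum>i=1..n. \<pi> i * Y (inv_into {1..n} per (per i))) = (\<Sum>i=1..n. \<pi> i * Y i)"
        using inv by (auto intro!: sum.cong)
      ultimately show "(\<Sum>i=1..n. \<gamma> i * X i) + (\<Sum>i=1..n. \<pi> i * Y i) + (\<Sum>j\<in>Z. gz $ j) = c"
        by (simp add: lot_point_def inner if_distrib[of "(*) _"] sum.If_cases)
    qed (auto simp: \<gamma>_def \<pi>_def)
    have "g \<bullet> v - c = \<pi> 1 * (f v - D)" if "v \<in> ?P" for v
    proof -
      obtain x y z where v: "v = (x, y, z)"
        by (cases v)
      have P: "x $ per 1 \<in> {0, 1}" "\<And>j. z $ j \<in> {0, 1}" "(\<Sum>j\<in>UNIV. z $ j) \<le> real k"
          "\<And>j. d j 1 * (1 - z $ j) \<le> y $ per 1" "y $ per 1 \<le> big_M d n 1 * x $ per 1"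
        using that l by (auto simp: v lot_sizing_set_def dest: bspec[of _ _ 1])
      \<comment> \<open>As \<open>k < CARD('m)\<close>, some scenario is kept. Its positive demand
        in period 1 forces production and hence a setup there.\<close>
      have "\<exists>j. z $ j = 0"
      proof (rule ccontr)
        assume "\<nexists>j. z $ j = 0"
        then have "z $ j = 1" for j
          using P(2)[of j] by auto
        then show False
          using P(3) kless by simp
      qed
      then obtain j where "z $ j = 0" ..
      then have "0 < y $ per 1"
        using P(4)[of j] demand_pos[of 1 j] l by simp
      then have "x $ per 1 = 1"
        using P(1,5) by auto
      \<comment> \<open>With budget zero no scenario can be given up; this is the second premise of
        \<open>functional_eq\<close>.\<close>
      moreover have "(\<lambda>j. z $ j) = (\<lambda>_. 0)" if "k = 0"
      proof
        fix j
        have "z $ j \<le> (\<Sum>j\<in>UNIV. z $ j)"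
          using P(2) by (intro member_le_sum) (auto, metis zero_le_one order_refl)
        then show "z $ j = 0"
          using P(2)[of j] P(3) that by auto
      qed
      ultimately show ?thesis
        using functional_eq[of "\<lambda>i. x $ per i" "\<lambda>j. z $ j" "\<lambda>i. y $ per i"]
        by (simp add: v inner f)
    qed
    then show "\<exists>r. \<forall>v\<in>?P. g \<bullet> v - c = r * (f v - D)"
      by blast
  qed
  then show ?thesis
    by (simp add: f_def C_def)
qed

end
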